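(* Let $(L,\tau)$ be a linear topological space over $\mathbb{R}$ in the weak sense (the vector space operations are not assumed to be continuous with respect to $\tau$), let $S$ be a stable distributed random variable with values in $L$, and let $L_0$ be a countable generated linear subspace of $L$. Then $$\mathbf{P}(S\in L_0)=0 \quad\text{or}\quad \mathbf{P}(S\in L_0)=1 .$$
   Context: **Linear topological space (weak sense).** $L$ is a vector space over $\mathbb{R}$ equipped with a non-trivial topology $\tau$ and its Borel sigma-algebra $B$. It is NOT assumed that $\tau$ is compatible with the linear structure; for instance, the map $(\lambda,x)\mapsto\lambda\cdot x$, $\lambda\in\mathbb{R}$, $x\in L$, may be discontinuous. $L$ is not assumed separable. $L^*$ denotes the space of continuous linear functionals $L\to\mathbb{R}$; it is assumed that $\dim L^*\ge 1$ (possibly $\dim L^*=\infty$). **Random variables.** $L$-valued random variables are Borel measurable maps from a probability space to $(L,B)$; the distribution of $\eta$ is $\mu_\eta(A)=\mathbf{P}(\eta\in A)$, $A\in B$. **Countable generated subspace.** A linear subspace $L_0$ of $L$ is countable generated if there exists a countable (or finite) family of continuous linear functionals $\{b_j\}$, $b_j\in L^*$, such that $L_0=\bigcap_j \ker b_j$, i.e. $x\in L_0$ if and only if $b_j(x)=0$ for all $j$. **Stable.** The non-degenerate distribution $\mu_S$ of an $L$-valued random variable $S$ is called (ordinary) stable if there exist a sequence of independent identically distributed $L$-valued random variables $\xi_1,\xi_2,\ldots$ and a non-random sequence of positive numbers $A(n)$ with $\lim_{n\to\infty}A(n)=\infty$ such that $S$ is the weak limit (limit in distribution) as $n\to\infty$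 of the normed sums $$\frac{\xi_1+\xi_2+\cdots+\xi_n}{A(n)} .$$ A random variable $S$ is called stable distributed if its distribution is stable. *)

theory Defs
  imports "HOL-Probability.Probability"
begin

text \<open>
  A linear topological space in the weak sense is a type of sort
  \<open>{real_vector, topological_space}\<close>: no axiom links the two structures, so addition and
  scalar multiplication may be discontinuous. Its Borel sigma-algebra is \<open>borel\<close>.
\<close>

definition continuous_dual :: "('a::{real_vector,topological_space} \<Rightarrow> real) set" where
  "continuous_dual = {b. linear b \<and> continuous_on UNIV b}"

definition countable_generated :: "'a::{real_vector,topological_space} set \<Rightarrow> bool" where
  "countable_generated L0 \<longleftrightarrow>
     subspace L0 \<and> (\<exists>B. countable B \<and> B \<subseteq> continuous_dual \<and> L0 = (\<Inter>b\<in>B. {x. b x = 0}))"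

text \<open>A law is degenerate if it is a Dirac measure. Singletons need not be Borel sets here, so
  this is expressed as equality with a Dirac law and not through the mass of a singleton.\<close>

definition nondegenerate :: "'a::topological_space measure \<Rightarrow> bool" where
  "nondegenerate \<mu> \<longleftrightarrow> \<not> (\<exists>x. \<mu> = return borel x)"

text \<open>
  Convergence in distribution of the maps \<open>Z n\<close> on \<open>N\<close> to the law \<open>\<mu>\<close>, tested on bounded
  continuous functions. In this setting sums of random variables need not be Borel measurable,
  and the integral of a non-measurable function is 0 by convention; hence the test is applied to
  those \<open>f\<close> for which every \<open>f (Z n)\<close> has an expectation. If the \<open>Z n\<close> are random variables,
  this is every \<open>f\<close>, and the notion is the usual weak convergence of laws
  (lemma \<open>weak_limit_iff_laws\<close>).
\<close>

definition weak_limit :: "'v measure \<Rightarrow> (nat \<Rightarrow> 'v \<Rightarrow> 'a::topological_space) \<Rightarrow> 'a measure \<Rightarrow> bool" where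
  "weak_limit N Z \<mu> \<longleftrightarrow>
     (\<forall>f::'a \<Rightarrow> real.
        continuous_on UNIV f \<and> bounded (range f) \<and> (\<forall>n. (\<lambda>w. f (Z n w)) \<in> borel_measurable N) \<longrightarrow>
        (\<lambda>n. \<integral>w. f (Z n w) \<partial>N) \<longlonglongrightarrow> (\<integral>x. f x \<partial>\<mu>))"

lemma weak_limit_iff_laws:
  fixes Z :: "nat \<Rightarrow> 'v \<Rightarrow> 'a::topological_space"
  assumes Z: "\<And>n. Z n \<in> borel_measurable N"
  shows "weak_limit N Z \<mu> \<longleftrightarrow>
     (\<forall>f::'a \<Rightarrow> real. continuous_on UNIV f \<and> bounded (range f) \<longrightarrow>
        (\<lambda>n. \<integral>x. f x \<partial>distr N borel (Z n)) \<longlonglongrightarrow> (\<integral>x. f x \<partial>\<mu>))"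
proof -
  have meas: "f \<in> borel_measurable borel" if "continuous_on UNIV f" for f :: "'a \<Rightarrow> real"
    using that by (rule borel_measurable_continuous_onI)
  have "(\<lambda>w. f (Z n w)) \<in> borel_measurable N" if "continuous_on UNIV f" for f :: "'a \<Rightarrow> real" and n
    using measurable_compose[OF Z meas[OF that]] .
  moreover have "(\<integral>x. f x \<partial>distr N borel (Z n)) = (\<integral>w. f (Z n w) \<partial>N)"
    if "continuous_on UNIV f" for f :: "'a \<Rightarrow> real" and n
    using integral_distr[OF Z meas[OF that]] .
  ultimately show ?thesis
    unfolding weak_limit_def by (auto cong: conj_cong imp_cong)
qed

text \<open>
  \<open>stable_law TYPE('v) \<mu>\<close>: the law \<open>\<mu>\<close> is stable, as witnessed by an i.i.d. sequence on some
  probability space with sample type \<open>'v\<close>. A definition cannot quantify existentially over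
  types; a theorem assuming \<open>stable_law TYPE('v) \<mu>\<close> with \<open>'v\<close> a type variable covers witnesses on
  every probability space. The sequence is indexed from 0, so the \<open>n\<close>-th sum is over \<open>i < n\<close>.
\<close>

definition stable_law :: "'v itself \<Rightarrow> 'a::{real_vector,topological_space} measure \<Rightarrow> bool" where
  "stable_law (_ :: 'v itself) \<mu> \<longleftrightarrow>
     nondegenerate \<mu> \<and>
     (\<exists>(N :: 'v measure) (\<xi> :: nat \<Rightarrow> 'v \<Rightarrow> 'a) (A :: nat \<Rightarrow> real).
        prob_space N \<and>
        prob_space.indep_vars N (\<lambda>_. borel) \<xi> UNIV \<and>
        (\<forall>i j. distr N borel (\<xi> i) = distr N borel (\<xi> j)) \<and>
        (\<forall>n\<ge>1. 0 < A n) \<and>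
        filterlim A at_top sequentially \<and>
        weak_limit N (\<lambda>n w. (\<Sum>i<n. \<xi> i w) /\<^sub>R A n) \<mu>)"

end

theory Submission
  imports Defs
begin

text \<open>
  Since \<open>L\<^sub>0\<close> is a countable intersection of kernels, it suffices that \<open>P (b S = 0)\<close> is 0 or 1 for
  each continuous functional \<open>b\<close>: one such probability equal to 0 makes \<open>P (S \<in> L\<^sub>0)\<close> vanish, and
  otherwise the countably many events \<open>b S = 0\<close> all have probability 1.

  Let \<open>Y = b S\<close>. Comparing the normed sums of orders \<open>n\<close> and \<open>2n\<close> along a subsequence on which
  \<open>A (2n) / A n\<close> or its inverse converges shows that \<open>Y\<^sub>1 + Y\<^sub>2\<close> has the law of \<open>c Y\<close> for some \<open>c\<close>,
  where \<open>Y\<^sub>1\<close> and \<open>Y\<^sub>2\<close> are independent copies of \<open>Y\<close>. If \<open>Y\<close> has an atom, let \<open>m\<close> be the maximal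
  mass of an atom. Some atom of \<open>Y\<^sub>1 + Y\<^sub>2\<close> also has mass at least \<open>m\<close>, which forces \<open>Y\<close> to be
  uniformly distributed on a finite set \<open>F\<close>. The value \<open>2 max F\<close> of \<open>Y\<^sub>1 + Y\<^sub>2\<close> arises in only one
  way, so it has mass \<open>m\<^sup>2\<close>; but all atoms of \<open>c Y\<close> have mass at least \<open>m\<close>, hence \<open>m = 1\<close>.
\<close>

section \<open>Atoms of a law whose self-convolution is a rescaling\<close>

lemma (in real_distribution) measure_convolution_singleton:
  shows "(\<lambda>x. prob {a - x}) \<in> borel_measurable borel"
    and "measure (M \<star> M) {a} = (\<integral>x. prob {a - x} \<partial>M)"
proof -
  have "{z \<in> space (borel \<Otimes>\<^sub>M M). fst z + snd z = a} \<in> sets (borel \<Otimes>\<^sub>M M)"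
    by measurable
  then have Q: "{z. fst z + snd z = a} \<in> sets (borel \<Otimes>\<^sub>M M)"
    by (simp add: space_pair_measure)
  have slice: "Pair x -` {z. fst z + snd z = a} = {a - x}" for x
    by auto
  have "(\<lambda>x. emeasure M (Pair x -` {z. fst z + snd z = a})) \<in> borel_measurable borel"
    using Q by (rule measurable_emeasure_Pair)
  then have em: "(\<lambda>x. emeasure M {a - x}) \<in> borel_measurable borel"
    unfolding slice .
  then show m: "(\<lambda>x. prob {a - x}) \<in> borel_measurable borel"
    unfolding measure_def by measurable
  have "{b. b + x \<in> {a}} = {a - x}" for x
    by auto
  then have "emeasure (M \<star> M) {a} = (\<integral>\<^sup>+x. emeasure M {a - x} \<partial>M)"
    by (subst convolution_emeasure) (auto simp: finite_measure_axioms)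
  then show "measure (M \<star> M) {a} = (\<integral>x. prob {a - x} \<partial>M)"
    unfolding measure_def using em
    by (subst integral_eq_nn_integral) (auto simp: emeasure_eq_measure)
qed

text \<open>More than \<open>1 / m\<close> points of mass at least \<open>m\<close> would have total
  mass above 1.\<close>

lemma (in real_distribution) finite_atoms_ge:
  assumes "0 < m"
  shows "finite {x. m \<le> prob {x}}"
proof (rule ccontr)
  assume inf: "infinite {x. m \<le> prob {x}}"
  obtain n :: nat where n: "1 < n * m"
    using ex_less_of_nat_mult[OF assms] by blast
  obtain T where T: "T \<subseteq> {x. m \<le> prob {x}}" "finite T" "card T = n"
    using infinite_arbitrarily_large[OF inf] by blast
  have "n * m \<le> (\<Sum>x\<in>T. prob {x})"
    using T sum_bounded_below[of T m "\<lambda>x. prob {x}"] by auto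
  also have "\<dots> = prob T"
    using T(2) by (intro finite_measure_eq_sum_singleton[symmetric]) auto
  also have "\<dots> \<le> 1" by simp
  finally show False using n by simp
qed

lemma (in real_distribution) atoms_of_convolution_scaling:
  assumes conv: "M \<star> M = distr M borel (\<lambda>x. c * x)"
  shows "prob {x} = 0 \<or> prob {x} = 1"
proof (rule ccontr)
  assume neg: "\<not> ?thesis"
  \<comment> \<open>Only finitely many atoms reach the mass of \<open>x\<close>, so a largest mass
    exists.\<close>
  define G where "G = {y. prob {x} \<le> prob {y}}"
  have "finite G"
    unfolding G_def using neg by (intro finite_atoms_ge) (simp add: zero_less_measure_iff)
  moreover have "x \<in> G" by (simp add: G_def)
  ultimately obtain x0 where x0: "x0 \<in> G" "\<And>y. y \<in> G \<Longrightarrow> prob {y} \<le> prob {x0}"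
    using Max_in[of "(\<lambda>y. prob {y}) ` G"] Max_ge[of "(\<lambda>y. prob {y}) ` G"] by fastforce
  define m where "m = prob {x0}"
  have le_m: "prob {y} \<le> m" for y
    using x0 \<open>x \<in> G\<close> unfolding m_def G_def by (metis linorder_linear mem_Collect_eq order_trans)
  have m_pos: "0 < m"
    using neg le_m[of x] by (smt (verit) measure_nonneg)
  define F where "F = {y. prob {y} = m}"
  have "F = {y. m \<le> prob {y}}"
    using le_m by (auto simp: F_def intro: antisym)
  then have fin: "finite F"
    using finite_atoms_ge[OF m_pos] by simp
  have "x0 \<in> F" by (simp add: F_def m_def)

  \<comment> \<open>Keeping the preimage as a set avoids division, so \<open>c\<close> may be 0 or
    negative.\<close>
  have scaled: "measure (M \<star> M) {z} = prob {y. c * y = z}" for z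
    unfolding conv by (subst measure_distr) (auto simp: vimage_def)
  \<comment> \<open>The preimage of \<open>a\<close> contains the heaviest atom \<open>x0\<close>,
    so \<open>a\<close> has mass at least \<open>m\<close> under \<open>M \<star> M\<close>. This
    mass is the mean of \<open>prob {a - x}\<close>, which never exceeds \<open>m\<close>; hence
    \<open>prob {a - x} = m\<close> almost everywhere.\<close>
  define a where "a = c * x0"
  have int: "integrable M (\<lambda>x. prob {b - x})" for b
    using measure_convolution_singleton(1)[of b]
    by (intro integrable_const_bound[of _ 1]) auto
  have "m \<le> measure (M \<star> M) {a}"
    unfolding scaled m_def a_def by (intro finite_measure_mono) auto
  then have "(\<integral>x. m - prob {a - x} \<partial>M) \<le> 0"
    using int by (simp add: measure_convolution_singleton(2) prob_space del: space_eq_univ)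
  moreover have "0 \<le> (\<integral>x. m - prob {a - x} \<partial>M)"
    using le_m by (intro integral_nonneg_AE) auto
  ultimately have "AE x in M. m - prob {a - x} = 0"
    using int le_m by (subst integral_nonneg_eq_0_iff_AE[symmetric]) auto
  then have AE1: "AE x in M. a - x \<in> F"
    by eventually_elim (simp add: F_def)
  \<comment> \<open>An almost sure property cannot fail at an atom.\<close>
  have atom: "P y" if "AE x in M. P x" "prob {y} \<noteq> 0" for P and y
  proof (rule ccontr)
    assume "\<not> P y"
    then have "AE x in M. x \<notin> {y}" using that(1) by (auto elim: eventually_mono)
    then have "prob {y} = 0" by (subst prob_eq_0) auto
    with that(2) show False by simp
  qed
  \<comment> \<open>The reflection about \<open>a / 2\<close> maps the finite set \<open>F\<close>
    injectively into itself, hence onto. So \<open>a - y\<close> in \<open>F\<close> gives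
    \<open>y\<close> in \<open>F\<close>, and \<open>M\<close> is concentrated on
    \<open>F\<close>.\<close>
  have "(\<lambda>x. a - x) ` F \<subseteq> F"
    using atom[OF AE1] m_pos by (auto simp: F_def)
  then have "(\<lambda>x. a - x) ` F = F"
    using fin by (intro endo_inj_surj) (auto simp: inj_on_def)
  then have "y \<in> F" if "a - y \<in> F" for y
    using imageI[OF that, of "\<lambda>x. a - x"] by simp
  then have AE2: "AE x in M. x \<in> F"
    using AE1 by (auto elim: eventually_mono)
  have in_F: "y \<in> F" if "prob {y} \<noteq> 0" for y
    using atom[OF AE2 that] .

  define \<mu> where "\<mu> = Max F"
  have \<mu>: "\<mu> \<in> F" and le_\<mu>: "\<And>y. y \<in> F \<Longrightarrow> y \<le> \<mu>"
    using fin \<open>x0 \<in> F\<close> unfolding \<mu>_def by (auto intro: Max_in)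
  \<comment> \<open>Two points of \<open>F\<close> add up to twice the maximum only if both equal
    it.\<close>
  have "AE x in M. prob {2 * \<mu> - x} = m * indicator {\<mu>} x"
    using AE2
  proof eventually_elim
    case (elim x)
    show ?case
    proof (cases "x = \<mu>")
      case False
      with le_\<mu>[OF elim] have "2 * \<mu> - x \<notin> F"
        using le_\<mu>[of "2 * \<mu> - x"] by auto
      with in_F False show ?thesis by auto
    qed (use \<mu> in \<open>simp add: F_def\<close>)
  qed
  then have "measure (M \<star> M) {2 * \<mu>} = (\<integral>x. m * indicator {\<mu>} x \<partial>M)"
    unfolding measure_convolution_singleton(2)
    using measure_convolution_singleton(1) by (intro integral_cong_AE) auto
  also have "\<dots> = m * m"
    using \<mu> by (simp add: F_def)
  finally have sq: "prob {y. c * y = 2 * \<mu>} = m * m"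
    unfolding scaled .
  \<comment> \<open>The preimage has positive mass \<open>m * m\<close>, so it meets
    \<open>F\<close> and contains a whole atom of mass \<open>m\<close>.\<close>
  have "m \<le> prob {y. c * y = 2 * \<mu>}"
  proof -
    obtain y where y: "c * y = 2 * \<mu>" "y \<in> F"
    proof -
      have "\<not> (AE y in M. c * y \<noteq> 2 * \<mu>)"
        using sq m_pos prob_eq_0[of "{y. c * y = 2 * \<mu>}"] by auto
      then show thesis
        using that AE2 by (meson eventually_mono)
    qed
    have "m = prob {y}" using y by (simp add: F_def)
    also have "\<dots> \<le> prob {y. c * y = 2 * \<mu>}"
      using y by (intro finite_measure_mono) auto
    finally show ?thesis .
  qed
  then have "1 \<le> m"
    using sq m_pos by simp
  then have "prob {y} = 1" if "y \<in> F" for y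
    using that prob_le_1[of "{y}"] unfolding F_def by simp
  then show False
    using in_F[of x] neg by blast
qed

section \<open>Characteristic functions and the scaling relation of the limit law\<close>

lemma char_convolution:
  assumes "real_distribution M" "real_distribution N"
  shows "char (M \<star> N) t = char M t * char N t"
proof -
  interpret M: real_distribution M by fact
  interpret N: real_distribution N by fact
  interpret pair_prob_space M N ..
  have int: "integrable (M \<Otimes>\<^sub>M N) (\<lambda>(x, y). iexp (t * x) * iexp (t * y))"
    by (intro P.integrable_const_bound[of _ 1]) (auto simp: norm_mult simp del: of_real_mult)
  have "char (M \<star> N) t = (\<integral>z. (case z of (x, y) \<Rightarrow> iexp (t * x) * iexp (t * y)) \<partial>(M \<Otimes>\<^sub>M N))"
    unfolding char_def convolution_def
    by (subst integral_distr) (auto simp: case_prod_unfold ring_distribs exp_add)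
  also have "\<dots> = (\<integral>x. (\<integral>y. iexp (t * x) * iexp (t * y) \<partial>N) \<partial>M)"
    using integral_fst[OF int] by simp
  also have "\<dots> = char M t * char N t"
    by (simp add: char_def)
  finally show ?thesis .
qed

lemma char_distr_scale:
  assumes "real_distribution M"
  shows "char (distr M borel (\<lambda>x. c * x)) t = char M (c * t)"
proof -
  interpret M: real_distribution M by fact
  show ?thesis
    unfolding char_def by (subst integral_distr) (auto simp: ac_simps)
qed

lemma real_distribution_convolution:
  assumes "real_distribution M" "real_distribution N"
  shows "real_distribution (M \<star> N)"
proof -
  interpret M: real_distribution M by fact
  interpret N: real_distribution N by fact
  interpret pair_prob_space M N ..
  show ?thesis
    unfolding convolution_def by (rule P.real_distribution_distr) measurable
qed

text \<open>Skorohod's representation replaces the locally uniform convergence of characteristic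
  functions, which the library does not state.\<close>

lemma char_tendsto_scaled:
  fixes \<mu> :: "nat \<Rightarrow> real measure"
  assumes \<mu>: "\<And>n. real_distribution (\<mu> n)" and M: "real_distribution M"
    and conv: "\<And>t. (\<lambda>n. char (\<mu> n) t) \<longlonglongrightarrow> char M t"
    and r: "r \<longlonglongrightarrow> c"
  shows "(\<lambda>n. char (\<mu> n) (r n)) \<longlonglongrightarrow> char M c"
proof -
  have "weak_conv_m \<mu> M"
    using \<mu> M conv by (rule levy_continuity)
  from Skorohod[OF \<mu> M this] obtain \<Omega> :: "real measure" and Z Y where
    "prob_space \<Omega>" and Z: "\<forall>n. Z n \<in> borel_measurable \<Omega>" "\<forall>n. distr \<Omega> borel (Z n) = \<mu> n"
    and Y: "Y \<in> measurable \<Omega> lborel" "distr \<Omega> borel Y = M"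
    and lim: "\<forall>x\<in>space \<Omega>. (\<lambda>n. Z n x) \<longlonglongrightarrow> Y x"
    by (elim exE conjE)
  interpret prob_space \<Omega> by fact
  have [measurable]: "Z n \<in> borel_measurable \<Omega>" for n
    using Z(1) by simp
  \<comment> \<open>Here \<open>r n * Z n x\<close> converges to \<open>c * Y x\<close> pointwise,
    and the integrands have norm 1.\<close>
  have "(\<lambda>n. CLINT x|\<Omega>. iexp (r n * Z n x)) \<longlonglongrightarrow> (CLINT x|\<Omega>. iexp (c * Y x))"
    using Z(1) Y(1) lim r
    by (intro integral_dominated_convergence[where w="\<lambda>_. 1"] AE_I2)
       (auto intro!: tendsto_intros simp del: of_real_mult, measurable)
  moreover have "(CLINT x|\<Omega>. iexp (r n * Z n x)) = char (\<mu> n) (r n)" for n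
    unfolding Z(2)[rule_format, symmetric] char_def using Z(1) by (subst integral_distr) auto
  moreover have "(CLINT x|\<Omega>. iexp (c * Y x)) = char M c"
    unfolding Y(2)[symmetric] char_def using Y(1) by (subst integral_distr) auto
  ultimately show ?thesis by simp
qed

text \<open>A normed sum of order \<open>2 * n\<close>, rescaled, is the sum of two independent
  normed sums of order \<open>n\<close>. The ratio \<open>A (2 * n) / A n\<close> need neither
  converge nor stay bounded, whence the subsequence and the two alternatives.\<close>

lemma stable_char_subsequence:
  fixes A :: "nat \<Rightarrow> real" and \<psi> :: "real \<Rightarrow> complex"
  assumes \<mu>: "\<And>n. real_distribution (\<mu> n)" and M: "real_distribution M"
    and char: "\<And>n t. char (\<mu> n) t = \<psi> (t / A n) ^ n"
    and conv: "\<And>t. (\<lambda>n. char (\<mu> n) t) \<longlonglongrightarrow> char M t"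
    and pos: "\<And>n. 1 \<le> n \<Longrightarrow> 0 < A n"
  obtains c where "\<And>t. char M (c * t) = (char M t)\<^sup>2"
    | c where "\<And>t. (char M (c * t))\<^sup>2 = char M t"
proof -
  \<comment> \<open>Both sides are \<open>\<psi> (t / A n) ^ (2 * n)\<close> in the first equation
    and \<open>\<psi> (t / A (2 * n)) ^ (2 * n)\<close> in the second. Since \<open>A 0\<close> may
    fail to be positive, \<open>n = 0\<close> is excluded.\<close>
  have rel: "char (\<mu> (2 * n)) (A (2 * n) / A n * t) = (char (\<mu> n) t)\<^sup>2"
    "(char (\<mu> n) (A n / A (2 * n) * t))\<^sup>2 = char (\<mu> (2 * n)) t" if "1 \<le> n" for n t
    using pos[of n] pos[of "2 * n"] that
    by (simp_all add: char power_mult[symmetric] mult.commute)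
  \<comment> \<open>Bolzano-Weierstrass, along the infinitely many indices at which \<open>f\<close>
    lies in \<open>{0..1}\<close>.\<close>
  have sub: "\<exists>c k. strict_mono k \<and> (\<lambda>n. f (k n)) \<longlonglongrightarrow> c \<and> (\<forall>n. 1 \<le> k n)"
    if f: "\<exists>\<^sub>F n in sequentially. 1 \<le> n \<and> f n \<in> {0..1}" for f :: "nat \<Rightarrow> real"
  proof -
    have inf: "infinite {n. 1 \<le> n \<and> f n \<in> {0..1}}"
      using f by (simp only: cofinite_eq_sequentially[symmetric] frequently_cofinite not_False_eq_True)
    define j where "j = enumerate {n. 1 \<le> n \<and> f n \<in> {0..1}}"
    have j: "strict_mono j" "\<And>n. 1 \<le> j n \<and> f (j n) \<in> {0..1}"
      unfolding j_def using strict_mono_enumerate[OF inf] enumerate_in_set[OF inf] by auto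
    obtain c l where "strict_mono l" "((\<lambda>n. f (j n)) \<circ> l) \<longlonglongrightarrow> c"
      using compact_Icc[of "0::real" 1, unfolded compact_def] j(2) by metis
    then show ?thesis
      using j by (intro exI[of _ c] exI[of _ "j \<circ> l"]) (auto simp: strict_mono_def comp_def)
  qed
  consider "\<exists>\<^sub>F n in sequentially. 1 \<le> n \<and> A (2 * n) / A n \<in> {0..1}"
    | "\<exists>\<^sub>F n in sequentially. 1 \<le> n \<and> A n / A (2 * n) \<in> {0..1}"
  proof -
    \<comment> \<open>Of two positive reciprocals, one is at most 1.\<close>
    have "1 \<le> n \<and> A (2 * n) / A n \<in> {0..1} \<or> 1 \<le> n \<and> A n / A (2 * n) \<in> {0..1}"
      if "1 \<le> n" for n
      using pos[of n] pos[of "2 * n"] that by (auto simp: divide_simps)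
    then have "\<exists>\<^sub>F n in sequentially. 1 \<le> n \<and> A (2 * n) / A n \<in> {0..1} \<or> 1 \<le> n \<and> A n / A (2 * n) \<in> {0..1}"
      by (intro eventually_frequently eventually_sequentiallyI[of 1]) auto
    then show ?thesis
      using that unfolding frequently_disj_iff by blast
  qed
  then show ?thesis
  proof cases
    case 1
    then obtain c k where k: "strict_mono k" "\<And>n. 1 \<le> k n"
      and lim: "(\<lambda>n. A (2 * k n) / A (k n)) \<longlonglongrightarrow> c"
      using sub[of "\<lambda>n. A (2 * n) / A n"] by auto
    have k2: "strict_mono (\<lambda>n. 2 * k n)"
      using k(1) by (simp add: strict_mono_def)
    have "char M (c * t) = (char M t)\<^sup>2" for t
    proof (rule LIMSEQ_unique)
      show "(\<lambda>n. char (\<mu> (2 * k n)) (A (2 * k n) / A (k n) * t)) \<longlonglongrightarrow> char M (c * t)"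
        by (rule char_tendsto_scaled[where \<mu> = "\<lambda>n. \<mu> (2 * k n)" and r = "\<lambda>n. A (2 * k n) / A (k n) * t"])
           (fact \<mu>, fact M, fact LIMSEQ_subseq_LIMSEQ[OF conv k2, unfolded comp_def],
            fact tendsto_mult_right[OF lim])
      show "(\<lambda>n. char (\<mu> (2 * k n)) (A (2 * k n) / A (k n) * t)) \<longlonglongrightarrow> (char M t)\<^sup>2"
        unfolding rel(1)[OF k(2)]
        using LIMSEQ_subseq_LIMSEQ[OF conv k(1), unfolded comp_def] by (rule tendsto_power)
    qed
    then show ?thesis by (rule that)
  next
    case 2
    then obtain c k where k: "strict_mono k" "\<And>n. 1 \<le> k n"
      and lim: "(\<lambda>n. A (k n) / A (2 * k n)) \<longlonglongrightarrow> c"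
      using sub[of "\<lambda>n. A n / A (2 * n)"] by auto
    have k2: "strict_mono (\<lambda>n. 2 * k n)"
      using k(1) by (simp add: strict_mono_def)
    have "(char M (c * t))\<^sup>2 = char M t" for t
    proof (rule LIMSEQ_unique)
      show "(\<lambda>n. (char (\<mu> (k n)) (A (k n) / A (2 * k n) * t))\<^sup>2) \<longlonglongrightarrow> (char M (c * t))\<^sup>2"
        by (rule tendsto_power, rule char_tendsto_scaled[where \<mu> = "\<lambda>n. \<mu> (k n)" and r = "\<lambda>n. A (k n) / A (2 * k n) * t"])
           (fact \<mu>, fact M, fact LIMSEQ_subseq_LIMSEQ[OF conv k(1), unfolded comp_def],
            fact tendsto_mult_right[OF lim])
      show "(\<lambda>n. (char (\<mu> (k n)) (A (k n) / A (2 * k n) * t))\<^sup>2) \<longlonglongrightarrow> char M t"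
        unfolding rel(2)[OF k(2)]
        using LIMSEQ_subseq_LIMSEQ[OF conv k2, unfolded comp_def] .
    qed
    then show ?thesis by (rule that)
  qed
qed

text \<open>Squaring the characteristic function corresponds to self-convolution, dilating its
  argument to scaling the variable. The second alternative for \<open>c\<close> reduces to the first
  with factor \<open>inverse c\<close>.\<close>

lemma stable_convolution_scaling:
  assumes \<mu>: "\<And>n. real_distribution (\<mu> n)" and M: "real_distribution M"
    and char: "\<And>n t. char (\<mu> n) t = \<psi> (t / A n) ^ n"
    and conv: "\<And>t. (\<lambda>n. char (\<mu> n) t) \<longlonglongrightarrow> char M t"
    and pos: "\<And>n. 1 \<le> n \<Longrightarrow> (0::real) < A n"
  obtains c where "M \<star> M = distr M borel (\<lambda>x. c * x)"
proof -
  interpret real_distribution M by fact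
  note result = that
  have conv_eq: thesis if "\<And>t. char M (c * t) = (char M t)\<^sup>2" for c
  proof (rule result)
    show "M \<star> M = distr M borel (\<lambda>x. c * x)"
      using that
      by (intro Levy_uniqueness real_distribution_convolution M real_distribution_distr ext)
         (auto simp: char_convolution[OF M M] char_distr_scale[OF M] power2_eq_square)
  qed
  show thesis
  proof (rule stable_char_subsequence[OF \<mu> M char conv pos])
    fix c assume "\<And>t. char M (c * t) = (char M t)\<^sup>2"
    then show thesis by (rule conv_eq)
  next
    fix c assume c: "\<And>t. (char M (c * t))\<^sup>2 = char M t"
    \<comment> \<open>For \<open>c = 0\<close> the law is a point mass at 0, and the junk value \<open>inverse 0 = 0\<close> is still a
      valid scaling factor.\<close>
    have "char M (inverse c * t) = (char M t)\<^sup>2" for t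
    proof (cases "c = 0")
      case True
      then have "char M s = 1" for s
        using c[of s] by (simp add: char_zero)
      then show ?thesis by simp
    next
      case False
      then show ?thesis using c[of "inverse c * t"] by (simp add: mult.assoc[symmetric])
    qed
    then show thesis by (rule conv_eq)
  qed
qed

section \<open>Passage to the real line by a continuous functional\<close>

text \<open>Composing a test function with \<open>b\<close> gives a test function with the same
  measurability condition, so \<open>Z n\<close> itself may be non-measurable.\<close>

lemma weak_limit_continuous_image:
  fixes b :: "'a::topological_space \<Rightarrow> 'b::topological_space"
  assumes lim: "weak_limit N Z \<mu>" and sets: "sets \<mu> = sets borel" and b: "continuous_on UNIV b"
  shows "weak_limit N (\<lambda>n w. b (Z n w)) (distr \<mu> borel b)"
proof (unfold weak_limit_def, intro allI impI, elim conjE)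
  fix f :: "'b \<Rightarrow> real"
  assume f: "continuous_on UNIV f" "bounded (range f)" "\<forall>n. (\<lambda>w. f (b (Z n w))) \<in> borel_measurable N"
  have "continuous_on UNIV (\<lambda>x. f (b x))"
    using continuous_on_compose2[OF f(1) b] by simp
  moreover have "bounded (range (\<lambda>x. f (b x)))"
    using f(2) by (rule bounded_subset) auto
  ultimately have "(\<lambda>n. \<integral>w. f (b (Z n w)) \<partial>N) \<longlonglongrightarrow> (\<integral>x. f (b x) \<partial>\<mu>)"
    using lim[unfolded weak_limit_def, rule_format, of "\<lambda>x. f (b x)"] f(3) by blast
  moreover have "b \<in> borel_measurable \<mu>"
    using borel_measurable_continuous_onI[OF b] measurable_cong_sets[OF sets refl] by blast
  ultimately show "(\<lambda>n. \<integral>w. f (b (Z n w)) \<partial>N) \<longlonglongrightarrow> (\<integral>x. f x \<partial>distr \<mu> borel b)"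
    using borel_measurable_continuous_onI[OF f(1)] by (simp add: integral_distr)
qed

text \<open>Test functions are real, so the real part \<open>cos\<close> and the imaginary part
  \<open>sin\<close> are treated separately.\<close>

lemma weak_limit_char:
  fixes Z :: "nat \<Rightarrow> 'v \<Rightarrow> real"
  assumes "prob_space N" and Z: "\<And>n. Z n \<in> borel_measurable N"
    and M: "real_distribution M" and lim: "weak_limit N Z M"
  shows "(\<lambda>n. char (distr N borel (Z n)) t) \<longlonglongrightarrow> char M t"
proof -
  interpret N: prob_space N by fact
  interpret M: real_distribution M by fact
  have conv: "(\<lambda>n. \<integral>w. f (Z n w) \<partial>N) \<longlonglongrightarrow> (\<integral>x. f x \<partial>M)"
    if "continuous_on UNIV f" "bounded (range f)" for f :: "real \<Rightarrow> real"
    using lim that measurable_compose[OF Z borel_measurable_continuous_onI[OF that(1)]]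
    unfolding weak_limit_def by simp
  have cos: "(\<lambda>n. \<integral>w. cos (t * Z n w) \<partial>N) \<longlonglongrightarrow> (\<integral>x. cos (t * x) \<partial>M)"
    by (rule conv) (auto intro!: continuous_intros boundedI[of _ 1])
  have sin: "(\<lambda>n. \<integral>w. sin (t * Z n w) \<partial>N) \<longlonglongrightarrow> (\<integral>x. sin (t * x) \<partial>M)"
    by (rule conv) (auto intro!: continuous_intros boundedI[of _ 1])
  have char_eq: "char (distr K borel X) t = Complex (\<integral>w. cos (t * X w) \<partial>K) (\<integral>w. sin (t * X w) \<partial>K)"
    if "prob_space K" and X: "X \<in> borel_measurable K" for K :: "'k measure" and X
  proof -
    interpret K: prob_space K by fact
    have int: "integrable K (\<lambda>w. iexp (t * X w))"
      using X by (intro K.integrable_iexp) auto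
    have "char (distr K borel X) t = (CLINT w|K. iexp (t * X w))"
      unfolding char_def using X by (subst integral_distr) auto
    then show ?thesis
      using integral_Re[OF int] integral_Im[OF int]
      by (simp add: complex_eq_iff Re_exp Im_exp del: integral_Re integral_Im)
  qed
  have "char M t = Complex (\<integral>x. cos (t * x) \<partial>M) (\<integral>x. sin (t * x) \<partial>M)"
    using char_eq[OF M.prob_space_axioms, of "\<lambda>x. x"] by (simp add: distr_id2)
  then show ?thesis
    using tendsto_Complex[OF cos sin] char_eq[OF N.prob_space_axioms Z] by simp
qed

text \<open>Linearity of \<open>b\<close> turns normed sums in \<open>L\<close> into normed sums of
  real i.i.d. variables, so discontinuous operations in \<open>L\<close> do no harm.\<close>

lemma stable_functional_zero_one:
  fixes \<mu> :: "'a::{real_vector,topological_space} measure"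
  assumes stable: "stable_law TYPE('v) \<mu>" and "prob_space \<mu>" and sets: "sets \<mu> = sets borel"
    and b: "b \<in> continuous_dual"
  shows "measure \<mu> {x. b x = 0} = 0 \<or> measure \<mu> {x. b x = 0} = 1"
proof -
  interpret \<mu>: prob_space \<mu> by fact
  have lin: "linear b" and cont: "continuous_on UNIV b"
    using b by (auto simp: continuous_dual_def)
  have b_borel: "b \<in> borel_measurable borel"
    using cont by (rule borel_measurable_continuous_onI)
  then have [measurable]: "b \<in> borel_measurable \<mu>"
    using measurable_cong_sets[OF sets refl] by blast
  from stable obtain N :: "'v measure" and \<xi> :: "nat \<Rightarrow> 'v \<Rightarrow> 'a" and A :: "nat \<Rightarrow> real" where
    "prob_space N" and indep: "prob_space.indep_vars N (\<lambda>_. borel) \<xi> UNIV"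
    and ident: "\<And>i j. distr N borel (\<xi> i) = distr N borel (\<xi> j)"
    and pos: "\<And>n. 1 \<le> n \<Longrightarrow> 0 < A n"
    and lim: "weak_limit N (\<lambda>n w. (\<Sum>i<n. \<xi> i w) /\<^sub>R A n) \<mu>"
    unfolding stable_law_def by blast
  interpret N: prob_space N by fact
  define M where "M = distr \<mu> borel b"
  have M: "real_distribution M"
    unfolding M_def by (rule \<mu>.real_distribution_distr) measurable
  \<comment> \<open>Each real summand is measurable, hence so is \<open>Z n\<close>, even if the
    sums in \<open>L\<close> are not.\<close>
  define Z where "Z n w = (\<Sum>i<n. b (\<xi> i w) / A n)" for n w
  have \<xi>: "\<xi> i \<in> borel_measurable N" for i
    using indep by (auto simp: N.indep_vars_def)
  note b\<xi>[measurable] = measurable_compose[OF \<xi> b_borel]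
  have [measurable]: "Z n \<in> borel_measurable N" for n
    unfolding Z_def by measurable
  have "b ((\<Sum>i<n. \<xi> i w) /\<^sub>R A n) = Z n w" for n w
    by (simp add: Z_def linear_scale[OF lin] linear_sum[OF lin] sum_distrib_left divide_inverse mult.commute)
  then have "weak_limit N Z M"
    using weak_limit_continuous_image[OF lim sets cont] by (simp add: M_def)
  then have conv: "(\<lambda>n. char (distr N borel (Z n)) t) \<longlonglongrightarrow> char M t" for t
    by (intro weak_limit_char N.prob_space_axioms M) auto
  \<comment> \<open>Independence gives a product of \<open>n\<close> factors, and identical
    distribution makes them equal. The characteristic function of \<open>b (\<xi> 0 w)\<close>
    serves as \<open>\<psi>\<close>.\<close>
  have char: "char (distr N borel (Z n)) t = char (distr N borel (\<lambda>w. b (\<xi> 0 w))) (t / A n) ^ n" for n t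
  proof -
    have "N.indep_vars (\<lambda>_. borel) (\<lambda>i w. b (\<xi> i w) / A n) {..<n}"
      using N.indep_vars_compose2[OF N.indep_vars_subset[OF indep], of "{..<n}" "\<lambda>_ x. b x / A n" "\<lambda>_. borel"] b_borel
      by simp
    then have "char (distr N borel (Z n)) t = (\<Prod>i<n. char (distr N borel (\<lambda>w. b (\<xi> i w) / A n)) t)"
      unfolding Z_def by (rule N.char_distr_sum)
    moreover have "char (distr N borel (\<lambda>w. b (\<xi> i w) / A n)) t = char (distr N borel (\<lambda>w. b (\<xi> 0 w))) (t / A n)" for i
    proof -
      have "distr N borel (\<lambda>w. b (\<xi> i w)) = distr (distr N borel (\<xi> i)) borel b"
        using \<xi> b_borel by (simp add: distr_distr comp_def)
      also have "\<dots> = distr (distr N borel (\<xi> 0)) borel b"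
        using ident by metis
      also have "\<dots> = distr N borel (\<lambda>w. b (\<xi> 0 w))"
        using \<xi> b_borel by (simp add: distr_distr comp_def)
      finally have "distr N borel (\<lambda>w. b (\<xi> i w)) = distr N borel (\<lambda>w. b (\<xi> 0 w))" .
      moreover have "char (distr N borel (\<lambda>w. b (\<xi> i w) / A n)) t = char (distr N borel (\<lambda>w. b (\<xi> i w))) (t / A n)"
        unfolding char_def by (subst (1 2) integral_distr) auto
      ultimately show ?thesis by simp
    qed
    ultimately show ?thesis by simp
  qed
  obtain c where "M \<star> M = distr M borel (\<lambda>x. c * x)"
    using stable_convolution_scaling[OF _ M char conv pos] by auto
  then have "measure M {0} = 0 \<or> measure M {0} = 1"
    by (rule real_distribution.atoms_of_convolution_scaling[OF M])
  moreover have "measure M {0} = measure \<mu> {x. b x = 0}"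
    unfolding M_def using sets_eq_imp_space_eq[OF sets]
    by (subst measure_distr) (auto simp: vimage_def)
  ultimately show ?thesis by simp
qed

section \<open>Countable intersections of kernels\<close>

theorem theorem2p1:
  fixes P :: "'w measure"
    and S :: "'w \<Rightarrow> 'a::{real_vector,topological_space}"
    and L0 :: "'a set"
  assumes "\<exists>U::'a set. open U \<and> U \<noteq> {} \<and> U \<noteq> UNIV"
    and "\<exists>b \<in> (continuous_dual :: ('a \<Rightarrow> real) set). b \<noteq> (\<lambda>_. 0)"
    and "prob_space P"
    and "S \<in> borel_measurable P"
    and "stable_law TYPE('v) (distr P borel S)"
    and "countable_generated L0"
  shows "measure P {w \<in> space P. S w \<in> L0} = 0 \<or> measure P {w \<in> space P. S w \<in> L0} = 1"
proof -
  interpret prob_space P by fact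
  obtain B :: "('a \<Rightarrow> real) set" where B: "countable B" "B \<subseteq> continuous_dual" "L0 = (\<Inter>b\<in>B. {x. b x = 0})"
    using assms(6) unfolding countable_generated_def by blast
  define E where "E b = {w \<in> space P. b (S w) = 0}" for b :: "'a \<Rightarrow> real"
  have borel: "b \<in> borel_measurable borel" if "b \<in> B" for b
    using B(2) that by (auto simp: continuous_dual_def intro: borel_measurable_continuous_onI)
  have E: "E b \<in> events" if "b \<in> B" for b
    unfolding E_def using measurable_compose[OF assms(4) borel[OF that]] by measurable
  have zero_one: "prob (E b) = 0 \<or> prob (E b) = 1" if "b \<in> B" for b
  proof -
    have "{x. b x = 0} \<in> sets borel"
      using borel[OF that] by measurable
    then have "measure (distr P borel S) {x. b x = 0} = prob (E b)"
      using assms(4) by (subst measure_distr) (auto simp: E_def intro!: arg_cong[where f = prob])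
    then show ?thesis
      using stable_functional_zero_one[OF assms(5) prob_space_distr[OF assms(4)] _ subsetD[OF B(2) that]]
      by simp
  qed
  have L0: "{w \<in> space P. S w \<in> L0} = {w \<in> space P. \<forall>b\<in>B. w \<in> E b}"
    by (auto simp: B(3) E_def)
  show ?thesis
  proof (cases "\<exists>b\<in>B. prob (E b) = 0")
    case True
    then obtain b where b: "b \<in> B" "prob (E b) = 0" by blast
    then have "prob {w \<in> space P. S w \<in> L0} \<le> prob (E b)"
      unfolding L0 by (intro finite_measure_mono E) auto
    then show ?thesis
      using b(2) by (simp add: measure_le_0_iff)
  next
    \<comment> \<open>Countably many almost sure events hold jointly almost surely. An empty
      \<open>B\<close>, for which \<open>L0\<close> is the whole space, falls under this
      case.\<close>
    case False
    then have "\<forall>b\<in>B. AE w in P. w \<in> E b"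
      using zero_one E by (auto simp: prob_eq_1)
    then have "AE w in P. \<forall>b\<in>B. w \<in> E b"
      by (simp add: AE_ball_countable[OF B(1)])
    moreover have "{w \<in> space P. \<forall>b\<in>B. w \<in> E b} \<in> events"
      using B(1) E by (intro sets.sets_Collect_countable_All') (auto simp: E_def)
    ultimately show ?thesis
      unfolding L0 by (auto simp: prob_eq_1 elim!: eventually_mono)
  qed
qed

end
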